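(* The Shapley group value $\phi^g$ is the unique group value $\xi^g$ over the set of all games $\mathcal G$ satisfying the following four properties: \begin{itemize} \item[(P3)] ($G$-null player) For all $N\in\mathcal N$, $C\subsetneq N$, $i\in N\setminus C$ and $v\in\mathcal G_N$: if $i$ is a null player in $v$, then $\xi^g(C\cup\{i\};N,v)=\xi^g(C;N,v)$. \item[(P5)] ($G$-linearity) $\xi^g(C;N,\alpha_1v+\alpha_2w)=\alpha_1\xi^g(C;N,v)+\alpha_2\xi^g(C;N,w)$ for all $N\in\mathcal N$, $C\subset N$, $\alpha_1,\alpha_2\in\mathbb R$ and $v,w\in\mathcal G_N$, where $(\alpha_1v+\alpha_2w)(S)=\alpha_1v(S)+\alpha_2w(S)$ for all $S\subset N$. \item[(P6)] ($G$-coalitional balanced contributions) For all $N\in\mathcal N$, $C\subsetneq N$, distinct $i,j\in N\setminus C$ and $v\in\mathcal G_N$, \begin{multline*} \bigl(\xi^g(C\cup\{i\};N,v)-\xi^g(C;N,v)\bigr)-\bigl(\xi^g(C\cup\{i\};N\setminus\{j\},v_{-j})-\xi^g(C;N\setminus\{j\},v_{-j})\bigr)\\ =\bigl(\xi^g(C\cup\{j\};N,v)-\xi^g(C;N,v)\bigr)-\bigl(\xi^g(C\cup\{j\};N\setminus\{i\},v_{-i})-\xi^g(C;N\setminus\{i\},v_{-i})\bigr), \end{multline*} where $v_{-i}\in\mathcal G_{N\setminus\{i\}}$ denotes the restriction of $v$ to the subsets of $N\setminus\{i\}$. \item[(P7)] ($G$-symmetry over pure bargaining games) $\xi^g(C;N,u_N)=\frac{1}{n-c+1}$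 for all $N\in\mathcal N$ and non-empty $C\subset N$, where $n=|N|$, $c=|C|$. \end{itemize} That is, $\phi^g$ satisfies these four properties, and any group value satisfying them equals $\phi^g$.
   Context: Let $\mathcal U=\{1,2,\dots\}$ and let $\mathcal N$ be the class of all non-empty finite subsets of $\mathcal U$. The symbol $\subset$ allows equality. For a finite set $N$, a game (characteristic function) on $N$ is a function $v:2^N\to\mathbb R$ with $v(\emptyset)=0$; $\mathcal G_N$ is the set of all games on $N$, and $\mathcal G=\bigcup_{N\in\mathcal N}\mathcal G_N$. Cardinalities of $N,S,C$ are denoted $n,s,c$. For $v\in\mathcal G_N$, the Shapley value of player $i\in N$ is $$\phi_i(N,v)=\sum_{S\subset N\setminus\{i\}}\frac{s!(n-s-1)!}{n!}\bigl(v(S\cup\{i\})-v(S)\bigr).$$ For non-empty $C\subset N$, the merging game $(N_C,v_C)$ has player set $N_C=(N\setminus C)\cup\{\mathbf c\}$, where $\mathbf c$ is a single new proxy player replacing $C$ (so $|N_C|=n-c+1$), and for $S\subset N_C$: $v_C(S)=v(S)$ if $\mathbf c\notin S$, and $v_C(S)=v((S\setminus\{\mathbf c\})\cup C)$ if $\mathbf c\in S$. A group value $\xi^g$ is a mapping assigning to every $N\in\mathcal N$, $v\in\mathcal G_N$ and $C\subset N$ a real number $\xi^g(C;N,v)$, with $\xi^g(\emptyset;N,v)=0$. The Shapley group value is the group value $\phi^g$ given by $\phi^g(C;N,v)=\phi_{\mathbf c}(N_C,v_C)$ for non-empty $C\subset N$ (and $\phi^g(\emptyset;N,v)=0$). The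 unanimity game with respect to the grand coalition, $u_N\in\mathcal G_N$, is given by $u_N(N)=1$ and $u_N(T)=0$ for $T\subsetneq N$. Player $i\in N$ is a null player in $v\in\mathcal G_N$ if $v(S\cup\{i\})=v(S)$ for all $S\subset N$. *)

theory Defs
  imports Complex_Main "HOL-Library.FuncSet"
begin

definition players :: "nat set" where
  "players = {1..}"

definition player_sets :: "nat set set" where
  "player_sets = {N. N \<subseteq> players \<and> finite N \<and> N \<noteq> {}}"

text \<open>
  Functions on the power set of \<open>N\<close> are represented by HOL functions that are
  extensional on \<open>Pow N\<close>, so that two games on \<open>N\<close> are equal iff they agree on all
  subsets of \<open>N\<close>.
\<close>

definition games :: "nat set \<Rightarrow> (nat set \<Rightarrow> real) set" where
  "games N = {v \<in> extensional (Pow N). v {} = 0}"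

definition lincomb_game ::
    "nat set \<Rightarrow> real \<Rightarrow> (nat set \<Rightarrow> real) \<Rightarrow> real \<Rightarrow> (nat set \<Rightarrow> real) \<Rightarrow> nat set \<Rightarrow> real" where
  "lincomb_game N a v b w = restrict (\<lambda>S. a * v S + b * w S) (Pow N)"

definition unanimity_game :: "nat set \<Rightarrow> nat set \<Rightarrow> real" where
  "unanimity_game N = restrict (\<lambda>S. if S = N then 1 else 0) (Pow N)"

definition remove_player :: "nat set \<Rightarrow> (nat set \<Rightarrow> real) \<Rightarrow> nat \<Rightarrow> nat set \<Rightarrow> real" where
  "remove_player N v i = restrict v (Pow (N - {i}))"

definition null_player :: "nat set \<Rightarrow> (nat set \<Rightarrow> real) \<Rightarrow> nat \<Rightarrow> bool" where
  "null_player N v i \<longleftrightarrow> i \<in> N \<and> (\<forall>S. S \<subseteq> N \<longrightarrow> v (S \<union> {i}) = v S)"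

text \<open>The natural subtraction does not truncate: \<open>card S < card N\<close> for every summand.\<close>

definition shapley :: "nat set \<Rightarrow> (nat set \<Rightarrow> real) \<Rightarrow> nat \<Rightarrow> real" where
  "shapley N v i =
    (\<Sum>S\<in>Pow (N - {i}).
      fact (card S) * fact (card N - card S - 1) / fact (card N) * (v (S \<union> {i}) - v S))"

text \<open>
  The label \<open>0\<close> is not an element of \<^const>\<open>players\<close>, so the proxy player is new for
  every player set.
\<close>

definition proxy :: nat where
  "proxy = 0"

definition merged_players :: "nat set \<Rightarrow> nat set \<Rightarrow> nat set" where
  "merged_players N C = (N - C) \<union> {proxy}"

definition merging_game :: "nat set \<Rightarrow> (nat set \<Rightarrow> real) \<Rightarrow> nat set \<Rightarrow> nat set \<Rightarrow> real" where
  "merging_game N v C =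
    restrict (\<lambda>S. if proxy \<in> S then v ((S - {proxy}) \<union> C) else v S) (Pow (merged_players N C))"

text \<open>
  A group value, applied as \<open>\<xi> C N v\<close>, is only meaningful when \<open>N \<in> player_sets\<close>,
  \<open>v \<in> games N\<close> and \<open>C \<subseteq> N\<close>. Values of the total HOL function at other arguments are
  irrelevant, and equality of group values means agreement at all meaningful arguments.
\<close>

type_synonym group_valuation = "nat set \<Rightarrow> nat set \<Rightarrow> (nat set \<Rightarrow> real) \<Rightarrow> real"

definition group_value :: "group_valuation \<Rightarrow> bool" where
  "group_value \<xi> \<longleftrightarrow> (\<forall>N\<in>player_sets. \<forall>v\<in>games N. \<xi> {} N v = 0)"

definition group_value_eq :: "group_valuation \<Rightarrow> group_valuation \<Rightarrow> bool" where
  "group_value_eq \<xi> \<psi> \<longleftrightarrow>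
    (\<forall>N\<in>player_sets. \<forall>v\<in>games N. \<forall>C. C \<subseteq> N \<longrightarrow> \<xi> C N v = \<psi> C N v)"

definition shapley_group_value :: group_valuation where
  "shapley_group_value C N v =
    (if C = {} then 0 else shapley (merged_players N C) (merging_game N v C) proxy)"

definition G_null_player :: "group_valuation \<Rightarrow> bool" where
  "G_null_player \<xi> \<longleftrightarrow>
    (\<forall>N\<in>player_sets. \<forall>C. C \<subset> N \<longrightarrow> (\<forall>i\<in>N - C. \<forall>v\<in>games N.
      null_player N v i \<longrightarrow> \<xi> (C \<union> {i}) N v = \<xi> C N v))"

definition G_linearity :: "group_valuation \<Rightarrow> bool" where
  "G_linearity \<xi> \<longleftrightarrow>
    (\<forall>N\<in>player_sets. \<forall>C. C \<subseteq> N \<longrightarrow> (\<forall>a b. \<forall>v\<in>games N. \<forall>w\<in>games N.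
      \<xi> C N (lincomb_game N a v b w) = a * \<xi> C N v + b * \<xi> C N w))"

definition G_coalitional_balanced_contributions :: "group_valuation \<Rightarrow> bool" where
  "G_coalitional_balanced_contributions \<xi> \<longleftrightarrow>
    (\<forall>N\<in>player_sets. \<forall>C. C \<subset> N \<longrightarrow> (\<forall>i\<in>N - C. \<forall>j\<in>N - C. i \<noteq> j \<longrightarrow> (\<forall>v\<in>games N.
      (\<xi> (C \<union> {i}) N v - \<xi> C N v)
        - (\<xi> (C \<union> {i}) (N - {j}) (remove_player N v j) - \<xi> C (N - {j}) (remove_player N v j))
      = (\<xi> (C \<union> {j}) N v - \<xi> C N v)
        - (\<xi> (C \<union> {j}) (N - {i}) (remove_player N v i) - \<xi> C (N - {i}) (remove_player N v i)))))"

definition G_symmetry_pure_bargaining :: "group_valuation \<Rightarrow> bool" where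
  "G_symmetry_pure_bargaining \<xi> \<longleftrightarrow>
    (\<forall>N\<in>player_sets. \<forall>C. C \<subseteq> N \<longrightarrow> C \<noteq> {} \<longrightarrow>
      \<xi> C N (unanimity_game N) = 1 / (real (card N) - real (card C) + 1))"

end

theory Submission
  imports Defs
begin

text \<open>
  \<^emph>\<open>Existence.\<close> With \<open>m = |N - C|\<close> the Shapley group value is
  \[ \sum_{S \subseteq N - C} \frac{s!\,(m-s)!}{(m+1)!}\,\bigl(v(S \cup C) - v(S)\bigr), \]
  a sum over the players outside \<open>C\<close> only (lemma \<open>shapley_group_value_eq_outside_sum\<close>). Splitting
  the sum according to whether \<open>S\<close> contains a given player reduces the \<open>G\<close>-null player property
  and balanced contributions to the Pascal-like rule
  \<open>w s (m + 1) + w (s + 1) (m + 1) = w s m\<close> for the weights (lemma \<open>shapley_weight_pascal\<close>).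

  \<^emph>\<open>Uniqueness.\<close> Three of the axioms are preserved by differences, so the difference \<open>d\<close> of two
  solutions satisfies them, and by the fourth it vanishes on the games \<open>u_N\<close>. One shows
  \<open>d = 0\<close> by induction on \<open>|N|\<close>. If \<open>d\<close> vanishes on smaller player sets, balanced
  contributions say \<open>d (C \<union> {i}) N v = d (C \<union> {j}) N v\<close>, whence \<open>d C N v\<close> depends on \<open>C\<close> only
  through its size (lemma \<open>exchange_invariant_imp_card_invariant\<close>). If \<open>v\<close> has a null player, groups
  of sizes \<open>k\<close> and \<open>k + 1\<close> then have the same value, which must be that of the empty group, \<open>0\<close>.

  A general game is reduced to these two kinds one player at a time: subtracting from \<open>v\<close> the game
  \<open>S \<mapsto> v (S - {i})\<close>, in which \<open>i\<close> is null, does not change \<open>d\<close> and leaves a game that vanishes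
  on coalitions without \<open>i\<close>. Once this has been done for every player, a multiple of \<open>u_N\<close> remains
  (lemma \<open>zero_on_games_if_zero_on_null_and_unanimity\<close>).
\<close>

section \<open>The Shapley group value as a sum over the outside players\<close>

definition shapley_weight :: "nat \<Rightarrow> nat \<Rightarrow> real" where
  "shapley_weight s m = fact s * fact (m - s) / fact (Suc m)"

definition outside_sum :: "nat set \<Rightarrow> nat set \<Rightarrow> (nat set \<Rightarrow> real) \<Rightarrow> real" where
  "outside_sum A C v = (\<Sum>S\<in>Pow A. shapley_weight (card S) (card A) * (v (S \<union> C) - v S))"

text \<open>
  In probabilistic terms: a weight is the probability that, in a random order of \<open>m\<close> players and a
  proxy, a given set of \<open>s\<close> players is exactly the set preceding the proxy. A further player comes
  either after the proxy or before it.
\<close>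

lemma shapley_weight_pascal:
  assumes "s \<le> m"
  shows "shapley_weight s (Suc m) + shapley_weight (Suc s) (Suc m) = shapley_weight s m"
proof -
  have num: "fact s * fact (Suc m - s) + fact (Suc s) * fact (m - s)
      = real (Suc (Suc m)) * (fact s * fact (m - s))"
    using assms by (simp add: Suc_diff_le algebra_simps of_nat_diff)
  have "shapley_weight s (Suc m) + shapley_weight (Suc s) (Suc m)
      = (fact s * fact (Suc m - s) + fact (Suc s) * fact (m - s)) / fact (Suc (Suc m))"
    unfolding shapley_weight_def by (simp only: diff_Suc_Suc add_divide_distrib)
  also have "\<dots> = real (Suc (Suc m)) * (fact s * fact (m - s)) / (real (Suc (Suc m)) * fact (Suc m))"
    unfolding num by (simp only: fact_Suc[of "Suc m"] of_nat_mult of_nat_fact)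
  also have "\<dots> = shapley_weight s m"
    unfolding shapley_weight_def by (rule mult_divide_mult_cancel_left) simp
  finally show ?thesis .
qed

lemma shapley_group_value_eq_outside_sum:
  assumes "N \<in> player_sets" "C \<subseteq> N"
  shows "shapley_group_value C N v = outside_sum (N - C) C v"
proof (cases "C = {}")
  case True
  then show ?thesis by (simp add: shapley_group_value_def outside_sum_def)
next
  case False
  have fin: "finite N" and new: "proxy \<notin> N"
    using assms by (auto simp: player_sets_def players_def proxy_def)
  have others: "merged_players N C - {proxy} = N - C"
    using new by (auto simp: merged_players_def)
  have card: "card (merged_players N C) = Suc (card (N - C))"
    using fin new by (simp add: merged_players_def)
  have "merging_game N v C (S \<union> {proxy}) = v (S \<union> C)" "merging_game N v C S = v S"
    if "S \<subseteq> N - C" for S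
  proof -
    have "proxy \<notin> S" using that new by blast
    then show "merging_game N v C (S \<union> {proxy}) = v (S \<union> C)" "merging_game N v C S = v S"
      using that by (auto simp: merging_game_def merged_players_def)
  qed
  then show ?thesis
    using False unfolding shapley_group_value_def shapley_def others card outside_sum_def
    by (auto simp: shapley_weight_def intro!: sum.cong)
qed

lemma sum_Pow_insert:
  fixes f :: "'a set \<Rightarrow> 'b::comm_monoid_add"
  assumes "finite A" "i \<notin> A"
  shows "sum f (Pow (insert i A)) = (\<Sum>S\<in>Pow A. f S + f (insert i S))"
proof -
  have "inj_on (insert i) (Pow A)" using assms(2) by (auto simp: inj_on_def)
  moreover have "Pow A \<inter> insert i ` Pow A = {}" using assms(2) by auto
  ultimately show ?thesis
    using assms(1)
    by (simp add: Pow_insert sum.union_disjoint sum.reindex sum.distrib)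
qed

lemma outside_sum_insert:
  assumes "finite A" "i \<notin> A"
  shows "outside_sum (insert i A) C v =
    (\<Sum>S\<in>Pow A. shapley_weight (card S) (Suc (card A)) * (v (S \<union> C) - v S)
      + shapley_weight (Suc (card S)) (Suc (card A)) * (v (insert i (S \<union> C)) - v (insert i S)))"
proof -
  have "finite S \<and> i \<notin> S" if "S \<in> Pow A" for S
    using that assms by (auto intro: finite_subset)
  then show ?thesis
    using assms unfolding outside_sum_def sum_Pow_insert[OF assms]
    by (intro sum.cong refl) simp
qed

lemma outside_sum_cong:
  assumes "\<And>S. S \<subseteq> A \<union> C \<Longrightarrow> v S = w S"
  shows "outside_sum A C v = outside_sum A C w"
  unfolding outside_sum_def
proof (intro sum.cong refl)
  fix S assume "S \<in> Pow A"
  then have "v (S \<union> C) = w (S \<union> C)" "v S = w S" by (auto intro!: assms)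
  then show "shapley_weight (card S) (card A) * (v (S \<union> C) - v S)
      = shapley_weight (card S) (card A) * (w (S \<union> C) - w S)" by simp
qed

section \<open>The axioms hold for the Shapley group value\<close>

lemma shapley_G_null_player: "G_null_player shapley_group_value"
  unfolding G_null_player_def
proof (intro ballI allI impI)
  fix N C i v
  assume N: "N \<in> player_sets" and C: "C \<subset> N" and i: "i \<in> N - C"
    and null: "null_player N v i"
  define A where "A = N - insert i C"
  have A: "finite A" "i \<notin> A" "N - C = insert i A" "A \<subseteq> N"
    using N C i by (auto simp: A_def player_sets_def)
  have "outside_sum (insert i A) C v = outside_sum A (insert i C) v"
    unfolding outside_sum_insert[OF A(1,2)]
    unfolding outside_sum_def
  proof (intro sum.cong refl)
    fix S assume S: "S \<in> Pow A"
    have ignore: "v (insert i T) = v T" if "T \<subseteq> N" for T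
      using null that by (simp add: null_player_def)
    have "v (insert i (S \<union> C)) = v (S \<union> C)" "v (insert i S) = v S"
      using S C A(4) by (auto intro!: ignore)
    moreover have "card S \<le> card A" using S A(1) by (simp add: card_mono)
    note shapley_weight_pascal[OF this, symmetric]
    ultimately show "shapley_weight (card S) (Suc (card A)) * (v (S \<union> C) - v S)
        + shapley_weight (Suc (card S)) (Suc (card A)) * (v (insert i (S \<union> C)) - v (insert i S))
        = shapley_weight (card S) (card A) * (v (S \<union> insert i C) - v S)"
      by (simp add: distrib_right)
  qed
  moreover have "shapley_group_value (C \<union> {i}) N v = outside_sum A (insert i C) v"
    using shapley_group_value_eq_outside_sum[OF N, of "insert i C" v] C i by (simp add: A_def)
  moreover have "shapley_group_value C N v = outside_sum (insert i A) C v"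
    using shapley_group_value_eq_outside_sum[OF N, of C v] C A(3) by auto
  ultimately show "shapley_group_value (C \<union> {i}) N v = shapley_group_value C N v" by simp
qed

lemma shapley_G_linearity: "G_linearity shapley_group_value"
  unfolding G_linearity_def
proof (intro ballI allI impI)
  fix N C a b v w
  assume N: "N \<in> player_sets" and C: "C \<subseteq> N"
  have "outside_sum (N - C) C (lincomb_game N a v b w)
      = outside_sum (N - C) C (\<lambda>S. a * v S + b * w S)"
    by (rule outside_sum_cong) (use C in \<open>auto simp: lincomb_game_def\<close>)
  also have "\<dots> = a * outside_sum (N - C) C v + b * outside_sum (N - C) C w"
    unfolding outside_sum_def
    by (simp add: sum_distrib_left algebra_simps sum.distrib sum_subtractf)
  finally show "shapley_group_value C N (lincomb_game N a v b w)
      = a * shapley_group_value C N v + b * shapley_group_value C N w"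
    by (simp add: shapley_group_value_eq_outside_sum[OF N C])
qed

text \<open>
  This is balanced contributions with \<open>A = N - (C \<union> {i, j})\<close>, once the value of \<open>C\<close> in \<open>N\<close> is
  cancelled from both sides. On the left, the coefficient of \<open>v (insert i (S \<union> C))\<close> is zero by
  the Pascal-like rule, and the coefficients of \<open>v (insert i S)\<close> and \<open>v (insert j S)\<close> coincide;
  so the left-hand side is symmetric in \<open>i\<close> and \<open>j\<close>.
\<close>

lemma outside_sum_balanced:
  assumes "finite A" "i \<notin> A" "j \<notin> A"
  shows "outside_sum (insert j A) (insert i C) v - outside_sum A (insert i C) v
        + outside_sum (insert i A) C v
      = outside_sum (insert i A) (insert j C) v - outside_sum A (insert j C) v
        + outside_sum (insert j A) C v"
  unfolding outside_sum_insert[OF assms(1,2)] outside_sum_insert[OF assms(1,3)]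
  unfolding outside_sum_def sum_subtractf[symmetric] sum.distrib[symmetric]
proof (intro sum.cong refl)
  fix S assume "S \<in> Pow A"
  then have "card S \<le> card A" using assms(1) by (simp add: card_mono)
  note pascal = shapley_weight_pascal[OF this, symmetric]
  show "shapley_weight (card S) (Suc (card A)) * (v (S \<union> insert i C) - v S) +
       shapley_weight (Suc (card S)) (Suc (card A)) *
         (v (insert j (S \<union> insert i C)) - v (insert j S)) -
       shapley_weight (card S) (card A) * (v (S \<union> insert i C) - v S) +
       (shapley_weight (card S) (Suc (card A)) * (v (S \<union> C) - v S) +
       shapley_weight (Suc (card S)) (Suc (card A)) *
         (v (insert i (S \<union> C)) - v (insert i S))) =
       shapley_weight (card S) (Suc (card A)) * (v (S \<union> insert j C) - v S) +
       shapley_weight (Suc (card S)) (Suc (card A)) *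
         (v (insert i (S \<union> insert j C)) - v (insert i S)) -
       shapley_weight (card S) (card A) * (v (S \<union> insert j C) - v S) +
       (shapley_weight (card S) (Suc (card A)) * (v (S \<union> C) - v S) +
       shapley_weight (Suc (card S)) (Suc (card A)) *
         (v (insert j (S \<union> C)) - v (insert j S)))"
    unfolding pascal by (simp add: insert_commute[of i j] algebra_simps)
qed

lemma shapley_group_value_remove_player:
  assumes "N \<in> player_sets" "C \<subseteq> N - {i}" "N - {i} \<noteq> {}"
  shows "shapley_group_value C (N - {i}) (remove_player N v i) = outside_sum (N - {i} - C) C v"
proof -
  have "N - {i} \<in> player_sets" using assms by (auto simp: player_sets_def)
  then have "shapley_group_value C (N - {i}) (remove_player N v i)
      = outside_sum (N - {i} - C) C (remove_player N v i)"
    using assms by (simp add: shapley_group_value_eq_outside_sum)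
  also have "\<dots> = outside_sum (N - {i} - C) C v"
    by (rule outside_sum_cong) (use assms(2) in \<open>auto simp: remove_player_def\<close>)
  finally show ?thesis .
qed

lemma shapley_G_coalitional_balanced_contributions:
  "G_coalitional_balanced_contributions shapley_group_value"
  unfolding G_coalitional_balanced_contributions_def
proof (intro ballI allI impI)
  fix N C i j v
  assume N: "N \<in> player_sets" and C: "C \<subset> N" and i: "i \<in> N - C" and j: "j \<in> N - C"
    and "i \<noteq> j"
  define A where "A = N - insert i (insert j C)"
  have A: "finite A" "i \<notin> A" "j \<notin> A" using N by (auto simp: A_def player_sets_def)
  have "N - insert i C = insert j A" "N - insert j C = insert i A"
    "N - {j} - insert i C = A" "N - {i} - insert j C = A"
    "N - {j} - C = insert i A" "N - {i} - C = insert j A"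
    using C i j \<open>i \<noteq> j\<close> by (auto simp: A_def)
  moreover have "insert i C \<subseteq> N" "insert j C \<subseteq> N" "C \<subseteq> N"
    "insert i C \<subseteq> N - {j}" "insert j C \<subseteq> N - {i}" "C \<subseteq> N - {j}" "C \<subseteq> N - {i}"
    "N - {j} \<noteq> {}" "N - {i} \<noteq> {}"
    using C i j \<open>i \<noteq> j\<close> by auto
  ultimately show "(shapley_group_value (C \<union> {i}) N v - shapley_group_value C N v)
        - (shapley_group_value (C \<union> {i}) (N - {j}) (remove_player N v j)
          - shapley_group_value C (N - {j}) (remove_player N v j))
      = (shapley_group_value (C \<union> {j}) N v - shapley_group_value C N v)
        - (shapley_group_value (C \<union> {j}) (N - {i}) (remove_player N v i)
          - shapley_group_value C (N - {i}) (remove_player N v i))"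
    using outside_sum_balanced[OF A, of C v]
    by (simp add: shapley_group_value_eq_outside_sum[OF N] shapley_group_value_remove_player[OF N])
qed

text \<open>
  The proxy is pivotal in a unanimity game only when it comes last.
\<close>

lemma shapley_G_symmetry_pure_bargaining: "G_symmetry_pure_bargaining shapley_group_value"
  unfolding G_symmetry_pure_bargaining_def
proof (intro ballI allI impI)
  fix N C :: "nat set"
  assume N: "N \<in> player_sets" and C: "C \<subseteq> N" "C \<noteq> {}"
  have fin: "finite N" using N by (simp add: player_sets_def)
  let ?m = "card (N - C)"
  have "outside_sum (N - C) C (unanimity_game N)
      = (\<Sum>S\<in>Pow (N - C). if S = N - C then shapley_weight ?m ?m else 0)"
    unfolding outside_sum_def
  proof (intro sum.cong refl)
    fix S assume "S \<in> Pow (N - C)"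
    then have "S \<union> C \<subseteq> N" "S \<subseteq> N" "S \<noteq> N" "S \<union> C = N \<longleftrightarrow> S = N - C" using C by blast+
    then show "shapley_weight (card S) ?m * (unanimity_game N (S \<union> C) - unanimity_game N S)
        = (if S = N - C then shapley_weight ?m ?m else 0)"
      by (simp add: unanimity_game_def)
  qed
  also have "\<dots> = shapley_weight ?m ?m" using fin by simp
  also have "\<dots> = 1 / (real ?m + 1)"
    by (simp add: shapley_weight_def del: of_nat_Suc)
  also have "real ?m = real (card N) - real (card C)"
    using C fin by (simp add: card_Diff_subset finite_subset card_mono of_nat_diff)
  finally show "shapley_group_value C N (unanimity_game N)
      = 1 / (real (card N) - real (card C) + 1)"
    by (simp add: shapley_group_value_eq_outside_sum[OF N C(1)])
qed

section \<open>Uniqueness\<close>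

text \<open>
  Any two sets of equal size are joined by successive exchanges of one element for another.
\<close>

lemma exchange_invariant_imp_card_invariant:
  fixes f :: "'a set \<Rightarrow> 'b"
  assumes "finite N"
    and exchange: "\<And>C i j. C \<subseteq> N \<Longrightarrow> i \<in> N - C \<Longrightarrow> j \<in> N - C \<Longrightarrow> f (insert i C) = f (insert j C)"
    and "C \<subseteq> N" "D \<subseteq> N" "card C = card D"
  shows "f C = f D"
  using assms(3-5)
proof (induction "card (C - D)" arbitrary: C)
  case 0
  have "finite C" "finite D" using \<open>finite N\<close> 0 by (auto intro: finite_subset)
  then have "C = D" using 0 by (intro card_subset_eq) auto
  then show ?case by simp
next
  case (Suc k)
  have fin: "finite C" "finite D" using \<open>finite N\<close> Suc.prems by (auto intro: finite_subset)
  obtain i where i: "i \<in> C" "i \<notin> D"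
    using Suc.hyps(2) by (metis Diff_iff card.empty equals0I nat.distinct(1))
  have "card (D - C) = card (C - D)"
    using card_Diff_subset_Int[of C D] card_Diff_subset_Int[of D C] Suc.prems(3) fin
    by (simp add: Int_commute)
  then obtain j where j: "j \<in> D" "j \<notin> C"
    using Suc.hyps(2) by (metis Diff_iff card.empty equals0I nat.distinct(1))
  let ?E = "insert j (C - {i})"
  have "card ?E = card C" using card_Suc_Diff1[OF fin(1) i(1)] fin j by simp
  moreover have "?E - D = (C - D) - {i}" using j by auto
  then have "k = card (?E - D)" using Suc.hyps(2) fin i by simp
  ultimately have "f ?E = f D" using Suc.hyps(1)[of ?E] Suc.prems j by auto
  moreover have "f (insert i (C - {i})) = f ?E" using exchange[of "C - {i}" i j] Suc.prems i j by auto
  ultimately show ?case using i by (simp add: insert_absorb)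
qed

text \<open>
  The induction shrinks the set \<open>N - A\<close> of players whose presence is not yet required for a
  coalition to have non-zero worth.
\<close>

lemma zero_on_games_if_zero_on_null_and_unanimity:
  fixes d :: "(nat set \<Rightarrow> real) \<Rightarrow> real"
  assumes "finite N" "N \<noteq> {}"
    and lin: "\<And>a b v w. v \<in> games N \<Longrightarrow> w \<in> games N \<Longrightarrow> d (lincomb_game N a v b w) = a * d v + b * d w"
    and null: "\<And>v i. v \<in> games N \<Longrightarrow> null_player N v i \<Longrightarrow> d v = 0"
    and unanimity: "d (unanimity_game N) = 0"
    and v: "v \<in> games N"
  shows "d v = 0"
proof -
  have "d v = 0"
    if "A \<subseteq> N" "v \<in> games N" "\<And>S. S \<subseteq> N \<Longrightarrow> \<not> A \<subseteq> S \<Longrightarrow> v S = 0" for A v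
    using that
  proof (induction "card (N - A)" arbitrary: A v)
    case 0
    then have "A = N" using \<open>finite N\<close> by auto
    have u: "unanimity_game N \<in> games N"
      using \<open>N \<noteq> {}\<close> by (auto simp: games_def unanimity_game_def)
    have "v = lincomb_game N (v N) (unanimity_game N) 0 (unanimity_game N)"
    proof (rule extensionalityI[of _ "Pow N"])
      fix S assume "S \<in> Pow N"
      then show "v S = lincomb_game N (v N) (unanimity_game N) 0 (unanimity_game N) S"
        using 0(4)[of S] \<open>A = N\<close> by (auto simp: lincomb_game_def unanimity_game_def)
    qed (use 0 in \<open>auto simp: games_def lincomb_game_def\<close>)
    then have "d v = d (lincomb_game N (v N) (unanimity_game N) 0 (unanimity_game N))"
      by (rule arg_cong)
    then show ?case using lin[OF u u] unanimity by simp
  next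
    case (Suc k)
    obtain i where i: "i \<in> N" "i \<notin> A"
      using Suc.hyps(2) by (metis Diff_iff card.empty equals0I nat.distinct(1))
    define w where "w = restrict (\<lambda>S. v (S - {i})) (Pow N)"
    have w: "w \<in> games N" using Suc.prems(2) by (auto simp: w_def games_def)
    have "w (S \<union> {i}) = w S" if "S \<subseteq> N" for S using that i by (simp add: w_def)
    then have "d w = 0" using null[OF w, of i] i by (simp add: null_player_def)
    let ?v' = "lincomb_game N 1 v (- 1) w"
    have "d ?v' = 0"
    proof (rule Suc.hyps(1)[of "insert i A"])
      have "N - insert i A = N - A - {i}" by blast
      then show "k = card (N - insert i A)" using Suc.hyps(2) i \<open>finite N\<close> by simp
      show "insert i A \<subseteq> N" using i Suc.prems by simp
      show "?v' \<in> games N" using Suc.prems(2) w by (auto simp: games_def lincomb_game_def)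
      fix S assume S: "S \<subseteq> N" "\<not> insert i A \<subseteq> S"
      then have "?v' S = v S - v (S - {i})" by (simp add: lincomb_game_def w_def)
      also have "\<dots> = 0"
      proof (cases "i \<in> S")
        case True
        then have "\<not> A \<subseteq> S" "\<not> A \<subseteq> S - {i}" using S by auto
        then show ?thesis using Suc.prems(3)[of S] Suc.prems(3)[of "S - {i}"] S by auto
      qed simp
      finally show "?v' S = 0" .
    qed
    then show ?case using lin[OF Suc.prems(2) w, of 1 "- 1"] \<open>d w = 0\<close> by simp
  qed
  from this[of "{}"] show ?thesis using v by simp
qed

text \<open>
  Homogeneous form of uniqueness: with value \<open>0\<close> on pure bargaining games the axioms force the
  zero value.
\<close>

lemma group_value_zero:
  assumes gv: "group_value d" and null: "G_null_player d" and lin: "G_linearity d"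
    and bal: "G_coalitional_balanced_contributions d"
    and bargaining: "\<And>C N. N \<in> player_sets \<Longrightarrow> C \<subseteq> N \<Longrightarrow> C \<noteq> {} \<Longrightarrow> d C N (unanimity_game N) = 0"
    and "N \<in> player_sets" "v \<in> games N" "C \<subseteq> N"
  shows "d C N v = 0"
  using assms(6-8)
proof (induction "card N" arbitrary: N v C rule: less_induct)
  case less
  note N = less.prems(1)
  have fin: "finite N" and ne: "N \<noteq> {}" using N by (auto simp: player_sets_def)
  have reduced: "d D (N - {i}) (remove_player N w i) = 0"
    if "w \<in> games N" "i \<in> N" "D \<subseteq> N - {i}" "N - {i} \<noteq> {}" for D w i
  proof (rule less.hyps)
    show "card (N - {i}) < card N" using fin that by (intro card_Diff1_less)
    show "N - {i} \<in> player_sets" using N that by (auto simp: player_sets_def)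
    show "remove_player N w i \<in> games (N - {i})" using that by (auto simp: games_def remove_player_def)
  qed (use that in blast)
  have exchange: "d (insert i D) N w = d (insert j D) N w"
    if w: "w \<in> games N" and D: "D \<subseteq> N" "i \<in> N - D" "j \<in> N - D" for D i j w
  proof (cases "i = j")
    case False
    have red: "d E (N - {j}) (remove_player N w j) = 0" if "E \<subseteq> N - {j}" for E
      using reduced[OF w, of j E] that D False by auto
    have red': "d E (N - {i}) (remove_player N w i) = 0" if "E \<subseteq> N - {i}" for E
      using reduced[OF w, of i E] that D False by auto
    have "D \<subset> N" using D by auto
    then have "(d (D \<union> {i}) N w - d D N w)
        - (d (D \<union> {i}) (N - {j}) (remove_player N w j) - d D (N - {j}) (remove_player N w j))
      = (d (D \<union> {j}) N w - d D N w)
        - (d (D \<union> {j}) (N - {i}) (remove_player N w i) - d D (N - {i}) (remove_player N w i))"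
      using bal N w D False unfolding G_coalitional_balanced_contributions_def by blast
    moreover have "D \<union> {i} \<subseteq> N - {j}" "D \<subseteq> N - {j}" "D \<union> {j} \<subseteq> N - {i}" "D \<subseteq> N - {i}"
      using D False by auto
    ultimately show ?thesis by (simp add: red red')
  qed simp
  have size_only: "d D N w = d E N w"
    if "w \<in> games N" "D \<subseteq> N" "E \<subseteq> N" "card D = card E" for D E w
    by (rule exchange_invariant_imp_card_invariant[where f = "\<lambda>D. d D N w", OF fin])
      (fact exchange[OF that(1)] that)+
  have null_zero: "d D N w = 0" if w: "w \<in> games N" and i: "null_player N w i" and D: "D \<subseteq> N" for D w i
    using D
  proof (induction "card D" arbitrary: D)
    case 0
    then have "D = {}" using fin by (metis card_0_eq finite_subset)
    then show ?case using gv N w by (simp add: group_value_def)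
  next
    case (Suc k)
    have "i \<in> N" using i by (simp add: null_player_def)
    have "k \<le> card (N - {i})"
      using card_mono[OF fin Suc.prems] Suc.hyps(2) fin \<open>i \<in> N\<close> by simp
    \<comment> \<open>Sizes alone matter, so \<open>D\<close> may be traded for a group containing the null player.\<close>
    then obtain E where E: "E \<subseteq> N - {i}" "card E = k" by (rule obtain_subset_with_card_n)
    have "finite E" "i \<notin> E" using E fin by (auto intro: finite_subset)
    then have "card D = card (insert i E)" using E Suc.hyps(2) by simp
    then have "d D N w = d (insert i E) N w"
      using E \<open>i \<in> N\<close> by (intro size_only[OF w Suc.prems]) auto
    also have "\<dots> = d E N w"
    proof -
      have "E \<subset> N" "i \<in> N - E" using E \<open>i \<in> N\<close> by auto
      then have "d (E \<union> {i}) N w = d E N w"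
        using null[unfolded G_null_player_def, rule_format, OF N _ _ w i] by blast
      then show ?thesis by simp
    qed
    also have "\<dots> = 0" using Suc.hyps(1)[of E] E by auto
    finally show ?case .
  qed
  show ?case
  proof (rule zero_on_games_if_zero_on_null_and_unanimity[where d = "d C N", OF fin ne])
    show "d C N (lincomb_game N a u b w) = a * d C N u + b * d C N w"
      if "u \<in> games N" "w \<in> games N" for a b u w
      using lin N less.prems(3) that by (simp add: G_linearity_def)
    have "unanimity_game N \<in> games N" using ne by (auto simp: games_def unanimity_game_def)
    then show "d C N (unanimity_game N) = 0"
      using bargaining[OF N less.prems(3)] gv N by (cases "C = {}") (auto simp: group_value_def)
    show "d C N w = 0" if "w \<in> games N" "null_player N w i" for w i
      using null_zero that less.prems(3) .
  qed (fact less.prems(2))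
qed

lemma group_value_unique:
  assumes "group_value \<xi>" "G_null_player \<xi>" "G_linearity \<xi>"
      "G_coalitional_balanced_contributions \<xi>" "G_symmetry_pure_bargaining \<xi>"
    and "group_value \<psi>" "G_null_player \<psi>" "G_linearity \<psi>"
      "G_coalitional_balanced_contributions \<psi>" "G_symmetry_pure_bargaining \<psi>"
  shows "group_value_eq \<xi> \<psi>"
proof -
  define d where "d = (\<lambda>C N v. \<xi> C N v - \<psi> C N v)"
  have "group_value d" using assms(1,6) by (simp add: group_value_def d_def)
  moreover have "G_null_player d" using assms(2,7) by (simp add: G_null_player_def d_def)
  moreover have "G_linearity d"
    using assms(3,8) by (simp add: G_linearity_def d_def right_diff_distrib)
  moreover have "G_coalitional_balanced_contributions d"
    unfolding G_coalitional_balanced_contributions_def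
  proof (intro ballI allI impI)
    fix N C i j v
    assume h: "N \<in> player_sets" "C \<subset> N" "i \<in> N - C" "j \<in> N - C" "i \<noteq> j" "v \<in> games N"
    note b = assms(4)[unfolded G_coalitional_balanced_contributions_def, rule_format, OF h]
      assms(9)[unfolded G_coalitional_balanced_contributions_def, rule_format, OF h]
    show "(d (C \<union> {i}) N v - d C N v)
        - (d (C \<union> {i}) (N - {j}) (remove_player N v j) - d C (N - {j}) (remove_player N v j))
      = (d (C \<union> {j}) N v - d C N v)
        - (d (C \<union> {j}) (N - {i}) (remove_player N v i) - d C (N - {i}) (remove_player N v i))"
      unfolding d_def using b by linarith
  qed
  moreover have "d C N (unanimity_game N) = 0" if "N \<in> player_sets" "C \<subseteq> N" "C \<noteq> {}" for C N
    using assms(5,10) that by (simp add: G_symmetry_pure_bargaining_def d_def)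
  ultimately have "\<And>C N v. N \<in> player_sets \<Longrightarrow> v \<in> games N \<Longrightarrow> C \<subseteq> N \<Longrightarrow> d C N v = 0"
    by (rule group_value_zero)
  then show ?thesis by (simp add: group_value_eq_def d_def)
qed

theorem theorem2:
  shows "group_value shapley_group_value
      \<and> G_null_player shapley_group_value
      \<and> G_linearity shapley_group_value
      \<and> G_coalitional_balanced_contributions shapley_group_value
      \<and> G_symmetry_pure_bargaining shapley_group_value
      \<and> (\<forall>\<xi>. group_value \<xi>
            \<and> G_null_player \<xi>
            \<and> G_linearity \<xi>
            \<and> G_coalitional_balanced_contributions \<xi>
            \<and> G_symmetry_pure_bargaining \<xi>
          \<longrightarrow> group_value_eq \<xi> shapley_group_value)"
proof -
  have "group_value shapley_group_value"
    by (simp add: group_value_def shapley_group_value_def)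
  note shapley = this shapley_G_null_player shapley_G_linearity
    shapley_G_coalitional_balanced_contributions shapley_G_symmetry_pure_bargaining
  then show ?thesis using group_value_unique[OF _ _ _ _ _ shapley] by blast
qed

end
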